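(* Let $G$ be a finite connected simple graph with independence number $\alpha(G)$ and vertex connectivity $\kappa(G)$. If $\alpha(G) \le 2\kappa(G)+1$, then $G$ has a spanning generalized caterpillar.
   Context: Graphs are finite, connected, without loops or multiple edges. A generalized caterpillar is a tree $T$ in which all vertices of degree more than two (degrees taken in $T$) lie on a common path of $T$. A spanning generalized caterpillar of $G$ is a spanning tree of $G$ that is a generalized caterpillar. $\alpha(G)$ is the maximum size of an independent set of vertices, and $\kappa(G)$ is the usual vertex connectivity number (with $\kappa(K_n) = n-1$). *)

theory Defs
  imports "Graph_Theory.Graph_Theory"
begin

text \<open>
  Finite simple graphs are the symmetric, loop-free digraphs without parallel arcs of
  \<^locale>\<open>graph\<close>: an undirected edge is represented by its two opposite arcs.
\<close>

definition independent_set :: "('a, 'b) pre_digraph \<Rightarrow> 'a set \<Rightarrow> bool" where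
  "independent_set G S \<longleftrightarrow> S \<subseteq> verts G \<and> (\<forall>u\<in>S. \<forall>v\<in>S. \<not> u \<rightarrow>\<^bsub>G\<^esub> v)"

definition independence_number :: "('a, 'b) pre_digraph \<Rightarrow> nat" where
  "independence_number G = Max {card S | S. independent_set G S}"

text \<open>
  The least number of vertices whose removal leaves a disconnected graph or a single vertex; the
  second alternative gives the complete graph on \<open>n\<close> vertices connectivity \<open>n - 1\<close>. Requiring
  a proper subset keeps the null graph, which is not \<^const>\<open>connected\<close>, from being reached.
\<close>
definition vertex_connectivity :: "('a, 'b) pre_digraph \<Rightarrow> nat" where
  "vertex_connectivity G =
     Min {card S | S. S \<subset> verts G \<and>
       (\<not> connected (G \<restriction> (verts G - S)) \<or> card (verts G - S) = 1)}"

text \<open>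
  The predicates \<^const>\<open>tree\<close> and \<^const>\<open>spanning_tree\<close> are not usable here: they forbid
  directed cycles, including the closed walk \<open>u, v, u\<close> along the two arcs of one edge, and accept
  an acyclically oriented triangle. In a symmetric digraph without loops and parallel arcs, the
  cycles of length at least three are exactly the cycles of the undirected graph.
\<close>
definition undirected_tree :: "('a, 'b) pre_digraph \<Rightarrow> bool" where
  "undirected_tree T \<longleftrightarrow>
     graph T \<and> connected T \<and> \<not> (\<exists>p. pre_digraph.cycle T p \<and> 3 \<le> length p)"

text \<open>
  In a symmetric digraph the in-degree, which \<^const>\<open>verts3\<close> compares with two, is the degree.
\<close>
definition generalized_caterpillar :: "('a, 'b) pre_digraph \<Rightarrow> bool" where
  "generalized_caterpillar T \<longleftrightarrow>
     undirected_tree T \<and> (\<exists>p. vpath p T \<and> verts3 T \<subseteq> set p)"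

definition spanning_generalized_caterpillar ::
    "('a, 'b) pre_digraph \<Rightarrow> ('a, 'b) pre_digraph \<Rightarrow> bool" where
  "spanning_generalized_caterpillar T G \<longleftrightarrow> spanning T G \<and> generalized_caterpillar T"

end

theory Submission
  imports Defs
begin

text \<open>
  Write \<open>\<alpha>\<close> and \<open>\<kappa>\<close> for the independence number and the connectivity of \<open>G\<close>. The path version of
  a theorem of Kouider gives a path \<open>P\<close> with \<open>\<alpha>(G - P) \<le> \<alpha> - \<kappa> - 1 \<le> \<kappa>\<close>. Turning \<open>P\<close> into a clique
  does not decrease the connectivity, and the new graph has independence number at most \<open>\<kappa> + 1\<close>; so
  Kouider's theorem, applied once more, yields a Hamiltonian path \<open>Q\<close> of it (Chvatal and Erdos).
  Outside \<open>P\<close>, the path \<open>Q\<close> splits into segments made of original edges, each of which has an end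
  joined to \<open>P\<close> by an original edge. Hanging each segment on \<open>P\<close> by one such edge gives the
  caterpillar.

  For Kouider's theorem take \<open>P\<close> with \<open>\<alpha>(G - P)\<close> minimal, then a component \<open>B\<close> of \<open>G - P\<close> with as few
  vertices as possible, and let \<open>U\<close> be the rest of \<open>G - P\<close>. From the start of \<open>P\<close>, and after each
  neighbour of \<open>B\<close> on \<open>P\<close>, follow \<open>P\<close> until adding the traversed segment to \<open>U\<close> raises the
  independence number. This happens before the next neighbour of \<open>B\<close>, and no two of these segments
  are joined through \<open>U\<close>: otherwise \<open>P\<close> could be rerouted through \<open>B\<close>, leaving out only vertices
  that do not raise \<open>\<alpha>(U)\<close>. Hence the \<open>\<kappa> + 1\<close> or more increments add up.
\<close>

section \<open>Independence numbers of vertex sets\<close>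

locale adjacency =
  fixes E :: "'a \<Rightarrow> 'a \<Rightarrow> bool"
  assumes sym: "E u v \<Longrightarrow> E v u"
    and irrefl: "\<not> E u u"
begin

definition indep :: "'a set \<Rightarrow> bool" where
  "indep S \<longleftrightarrow> (\<forall>u\<in>S. \<forall>v\<in>S. \<not> E u v)"

definition alpha :: "'a set \<Rightarrow> nat" where
  "alpha S = Max (card ` {I. I \<subseteq> S \<and> indep I})"

definition apart :: "'a set \<Rightarrow> 'a set \<Rightarrow> bool" where
  "apart A B \<longleftrightarrow> (\<forall>a\<in>A. \<forall>b\<in>B. \<not> E a b)"

definition is_path :: "'a list \<Rightarrow> bool" where
  "is_path p \<longleftrightarrow> distinct p \<and> successively E p"

text \<open>The list \<open>R\<close> may be empty, so adjacent vertices are linked for every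
  \<open>U\<close>. It is a simple path so that a rerouted path can pass along it.\<close>

definition linked :: "'a set \<Rightarrow> 'a \<Rightarrow> 'a \<Rightarrow> bool" where
  "linked U u v \<longleftrightarrow> (\<exists>R. distinct R \<and> set R \<subseteq> U \<and> successively E (u # R @ [v]))"

lemma indep_subset: "indep S \<Longrightarrow> T \<subseteq> S \<Longrightarrow> indep T"
  unfolding indep_def by blast

lemma card_le_alpha:
  assumes "finite S" "I \<subseteq> S" "indep I"
  shows "card I \<le> alpha S"
  unfolding alpha_def using assms by (intro Max_ge) auto

lemma alpha_attained:
  assumes "finite S"
  obtains I where "I \<subseteq> S" "indep I" "card I = alpha S"
proof -
  have "alpha S \<in> card ` {I. I \<subseteq> S \<and> indep I}"
    unfolding alpha_def using assms by (intro Max_in) (auto simp: indep_def)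
  then show thesis using that by auto
qed

lemma alpha_empty [simp]: "alpha {} = 0"
proof -
  have "{I. I \<subseteq> {} \<and> indep I} = {{}}" by (auto simp: indep_def)
  then show ?thesis by (simp add: alpha_def)
qed

lemma alpha_mono:
  assumes "finite T" "S \<subseteq> T"
  shows "alpha S \<le> alpha T"
proof -
  obtain I where "I \<subseteq> S" "indep I" "card I = alpha S"
    using alpha_attained finite_subset[OF assms(2,1)] by blast
  then show ?thesis using card_le_alpha[OF assms(1), of I] assms(2) by auto
qed

lemma alpha_pos:
  assumes "finite S" "S \<noteq> {}"
  shows "0 < alpha S"
proof -
  obtain x where "x \<in> S" using assms(2) by blast
  then show ?thesis using card_le_alpha[OF assms(1), of "{x}"] irrefl by (auto simp: indep_def)
qed

lemma apart_commute: "apart A B \<longleftrightarrow> apart B A"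
  unfolding apart_def using sym by blast

lemma apart_subset: "apart A B \<Longrightarrow> A' \<subseteq> A \<Longrightarrow> B' \<subseteq> B \<Longrightarrow> apart A' B'"
  unfolding apart_def by blast

lemma alpha_Un_le:
  assumes "finite A" "finite B"
  shows "alpha (A \<union> B) \<le> alpha A + alpha B"
proof -
  obtain I where I: "I \<subseteq> A \<union> B" "indep I" "card I = alpha (A \<union> B)"
    by (rule alpha_attained[of "A \<union> B"]) (use assms in auto)
  have "(I \<inter> A) \<union> (I \<inter> B) = I" using I(1) by blast
  then have "card I \<le> card (I \<inter> A) + card (I \<inter> B)"
    using card_Un_le[of "I \<inter> A" "I \<inter> B"] by simp
  also have "\<dots> \<le> alpha A + alpha B"
    using I(2) assms by (intro add_mono card_le_alpha) (auto intro: indep_subset)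
  finally show ?thesis using I(3) by simp
qed

lemma alpha_Un_apart:
  assumes "finite A" "finite B" "A \<inter> B = {}" "apart A B"
  shows "alpha (A \<union> B) = alpha A + alpha B"
proof (rule antisym[OF alpha_Un_le])
  obtain I where I: "I \<subseteq> A" "indep I" "card I = alpha A"
    using alpha_attained assms by blast
  obtain J where J: "J \<subseteq> B" "indep J" "card J = alpha B"
    using alpha_attained assms by blast
  have "indep (I \<union> J)"
    using I J assms(4) sym unfolding indep_def apart_def by blast
  moreover have "card (I \<union> J) = card I + card J"
    using I J assms by (intro card_Un_disjoint) (auto intro: finite_subset)
  ultimately show "alpha A + alpha B \<le> alpha (A \<union> B)"
    using I J assms card_le_alpha[of "A \<union> B" "I \<union> J"] by auto
qed (use assms in auto)

section \<open>Links through a set, and modularity of the independence number\<close>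

lemma path_if_reachable:
  assumes "(\<lambda>u v. E u v \<and> u \<in> W \<and> v \<in> W)\<^sup>*\<^sup>* a b" "a \<in> W"
  shows "\<exists>R. R \<noteq> [] \<and> is_path R \<and> set R \<subseteq> W \<and> hd R = a \<and> last R = b"
  using assms
proof (induction rule: rtranclp_induct)
  case base
  then show ?case by (intro exI[of _ "[a]"]) (auto simp: is_path_def)
next
  case (step b c)
  then obtain R where R: "R \<noteq> []" "is_path R" "set R \<subseteq> W" "hd R = a" "last R = b" by blast
  \<comment> \<open>If the walk returns to the path, cutting the path at that vertex keeps it
    simple.\<close>
  show ?case
  proof (cases "c \<in> set R")
    case True
    then obtain R1 R2 where "R = R1 @ c # R2" by (meson split_list)
    moreover from this have "hd (R1 @ [c]) = hd R" by (cases R1) auto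
    ultimately show ?thesis
      using R(2-4) by (intro exI[of _ "R1 @ [c]"])
        (simp add: is_path_def successively_append_iff)
  next
    case False
    with R step.hyps(2) show ?thesis
      by (intro exI[of _ "R @ [c]"]) (auto simp: is_path_def successively_append_iff)
  qed
qed

text \<open>The part \<open>U1\<close> of \<open>U\<close> reachable from \<open>C\<close> through
  \<open>U\<close> is apart from \<open>D\<close>, and the remainder \<open>U2\<close> is apart from
  \<open>C\<close>. So \<open>U1 \<union> C\<close> and \<open>U2 \<union> D\<close> are apart, each
  of the four independence numbers is the sum of its values on these two blocks, and both sides
  agree.\<close>

lemma alpha_modular:
  assumes fin: "finite U" "finite C" "finite D"
    and disj: "C \<inter> U = {}" "D \<inter> U = {}" "C \<inter> D = {}"
    and unlinked: "\<And>u v. u \<in> C \<Longrightarrow> v \<in> D \<Longrightarrow> \<not> linked U u v"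
  shows "alpha (U \<union> C \<union> D) + alpha U = alpha (U \<union> C) + alpha (U \<union> D)"
proof -
  let ?r = "\<lambda>u v. E u v \<and> u \<in> U \<and> v \<in> U"
  define U1 where "U1 = {w \<in> U. \<exists>u\<in>C. \<exists>d\<in>U. E u d \<and> ?r\<^sup>*\<^sup>* d w}"
  define U2 where "U2 = U - U1"
  have U: "U = U1 \<union> U2" "U1 \<inter> U2 = {}" by (auto simp: U1_def U2_def)
  have U1U2: "apart U1 U2"
    unfolding apart_def U1_def U2_def by (auto intro: rtranclp.rtrancl_into_rtrancl)
  have CU2: "apart C U2"
    unfolding apart_def U1_def U2_def by blast
  have U1D: "apart U1 D"
    unfolding apart_def
  proof (intro ballI notI)
    fix w v assume w: "w \<in> U1" and v: "v \<in> D" and "E w v"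
    obtain u d where u: "u \<in> C" "d \<in> U" "E u d" "?r\<^sup>*\<^sup>* d w"
      using w unfolding U1_def by blast
    obtain R where "R \<noteq> []" "is_path R" "set R \<subseteq> U" "hd R = d" "last R = w"
      using path_if_reachable[OF u(4,2)] by blast
    then have "linked U u v"
      unfolding linked_def using u \<open>E w v\<close>
      by (intro exI[of _ R])
        (auto simp: is_path_def successively_append_iff successively_Cons)
    then show False using unlinked u(1) v by blast
  qed
  have CD: "apart C D"
    unfolding apart_def
  proof (intro ballI notI)
    fix u v assume "u \<in> C" "v \<in> D" "E u v"
    then have "linked U u v"
      unfolding linked_def by (intro exI[of _ "[]"]) auto
    then show False using unlinked \<open>u \<in> C\<close> \<open>v \<in> D\<close> by blast
  qed
  have fin': "finite U1" "finite U2" using fin(1) U(1) by (metis finite_Un)+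
  have ap: "apart (U1 \<union> C) (U2 \<union> D)" using U1U2 CU2 U1D CD unfolding apart_def by blast
  have "alpha (U1 \<union> C \<union> (U2 \<union> D)) = alpha (U1 \<union> C) + alpha (U2 \<union> D)"
    using fin fin' disj U by (intro alpha_Un_apart ap) auto
  moreover have "alpha (U1 \<union> U2) = alpha U1 + alpha U2"
    using fin fin' disj U by (intro alpha_Un_apart apart_subset[OF ap]) auto
  moreover have "alpha (U1 \<union> C \<union> U2) = alpha (U1 \<union> C) + alpha U2"
    using fin fin' disj U by (intro alpha_Un_apart apart_subset[OF ap]) auto
  moreover have "alpha (U1 \<union> (U2 \<union> D)) = alpha U1 + alpha (U2 \<union> D)"
    using fin fin' disj U by (intro alpha_Un_apart apart_subset[OF ap]) auto
  moreover have "U1 \<union> C \<union> (U2 \<union> D) = U \<union> C \<union> D" "U1 \<union> U2 = U" "U1 \<union> C \<union> U2 = U \<union> C"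
      "U1 \<union> (U2 \<union> D) = U \<union> D"
    using U by auto
  ultimately show ?thesis by simp
qed

text \<open>One set is added at a time: by \<open>alpha_modular\<close> it raises the independence
  number over \<open>U\<close> and the earlier sets by as much as over \<open>U\<close> alone, hence
  by at least one.\<close>

lemma alpha_unlinked_family:
  assumes "finite F" "finite U" "\<And>s. s \<in> F \<Longrightarrow> finite (D s)"
    and "\<And>s. s \<in> F \<Longrightarrow> D s \<inter> U = {}"
    and "\<And>s t. s \<in> F \<Longrightarrow> t \<in> F \<Longrightarrow> s \<noteq> t \<Longrightarrow> D s \<inter> D t = {}"
    and "\<And>s t u v. s \<in> F \<Longrightarrow> t \<in> F \<Longrightarrow> s \<noteq> t \<Longrightarrow> u \<in> D s \<Longrightarrow> v \<in> D t \<Longrightarrow> \<not> linked U u v"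
    and "\<And>s. s \<in> F \<Longrightarrow> alpha U < alpha (U \<union> D s)"
  shows "alpha U + card F \<le> alpha (U \<union> (\<Union>s\<in>F. D s))"
  using assms
proof (induction F rule: finite_induct)
  case (insert s F)
  have "alpha (U \<union> D s \<union> (\<Union>t\<in>F. D t)) + alpha U = alpha (U \<union> D s) + alpha (U \<union> (\<Union>t\<in>F. D t))"
  proof (rule alpha_modular)
    show "D s \<inter> (\<Union>t\<in>F. D t) = {}" using insert.prems(4) insert.hyps(2) by blast
    show "\<not> linked U u v" if "u \<in> D s" "v \<in> (\<Union>t\<in>F. D t)" for u v
      using that insert.prems(5) insert.hyps(2) by blast
  qed (use insert.prems insert.hyps in auto)
  moreover have "alpha U + card F \<le> alpha (U \<union> (\<Union>s\<in>F. D s))"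
  proof (rule insert.IH)
    show "\<not> linked U u v" if "t \<in> F" "t' \<in> F" "t \<noteq> t'" "u \<in> D t" "v \<in> D t'" for t t' u v
      using insert.prems(5)[of t t' u v] that by simp
  qed (use insert.prems(1-4,6) in simp_all)
  moreover have "alpha U < alpha (U \<union> D s)" using insert.prems(6) by simp
  ultimately show ?case using insert.hyps by (simp add: Un_assoc)
qed auto

lemma linked_commute: "linked U u v \<Longrightarrow> linked U v u"
proof -
  assume "linked U u v"
  then obtain R where R: "distinct R" "set R \<subseteq> U" "successively E (u # R @ [v])"
    unfolding linked_def by blast
  have "successively E (rev (u # R @ [v]))"
    using R(3) sym by (subst successively_rev) (auto elim: successively_mono)
  then show ?thesis unfolding linked_def using R by (intro exI[of _ "rev R"]) auto
qed

lemma is_path_rev: "is_path p \<Longrightarrow> is_path (rev p)"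
  unfolding is_path_def using sym by (auto simp: successively_rev elim: successively_mono)


section \<open>Kouider's theorem for paths\<close>

text \<open>
  The truncated subtraction covers the case that \<open>p\<close> is spanning.
\<close>
lemma path_dropping_independence:
  assumes fin: "finite V"
    and conn: "\<And>A B. A \<subseteq> V \<Longrightarrow> B \<subseteq> V \<Longrightarrow> A \<noteq> {} \<Longrightarrow> B \<noteq> {} \<Longrightarrow> A \<inter> B = {} \<Longrightarrow> apart A B
      \<Longrightarrow> k \<le> card (V - A - B)"
  obtains p where "is_path p" "set p \<subseteq> V" "alpha (V - set p) \<le> alpha V - (k + 1)"
proof -
  define good where "good p \<longleftrightarrow> is_path p \<and> set p \<subseteq> V" for p
  have "good []" by (simp add: good_def is_path_def)
  then obtain p0 where p0: "good p0" "\<And>q. good q \<Longrightarrow> alpha (V - set p0) \<le> alpha (V - set q)"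
    using ex_has_least_nat[of good "[]" "\<lambda>q. alpha (V - set q)"] by blast
  define a where "a = alpha (V - set p0)"
  have min1: "a \<le> alpha (V - set q)" if "good q" for q using p0(2) that by (simp add: a_def)
  show thesis
  proof (cases "V - set p0 = {}")
    case True
    then have "alpha (V - set p0) = 0" by (simp only: alpha_empty)
    then show thesis using p0(1) that[of p0] by (simp add: good_def)
  next
    case False
    \<comment> \<open>The last condition makes \<open>C\<close> a union of components of what
      \<open>q\<close> leaves over, so a smallest candidate is a single component.\<close>
    define cand where "cand = (\<lambda>(q, C). good q \<and> alpha (V - set q) = a \<and> C \<noteq> {} \<and> C \<subseteq> V - set q
        \<and> apart C (V - set q - C))"
    have "cand (p0, V - set p0)"
      using False p0(1) by (auto simp: cand_def a_def apart_def)
    then obtain pB where pB: "cand pB" "\<forall>qC. cand qC \<longrightarrow> card (snd pB) \<le> card (snd qC)"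
      using ex_has_least_nat[of cand "(p0, V - set p0)" "\<lambda>qC. card (snd qC)"] by blast
    obtain p B where pB_eq: "pB = (p, B)" by (cases pB)
    have cand: "cand (p, B)" and min2: "\<And>q C. cand (q, C) \<Longrightarrow> card B \<le> card C"
      using pB unfolding pB_eq by auto
    define U where "U = V - set p - B"
    have path: "distinct p" "successively E p" "set p \<subseteq> V"
      and a: "alpha (V - set p) = a" and B: "B \<noteq> {}" "B \<subseteq> V - set p" and BU: "apart B U"
      using cand by (auto simp: cand_def good_def is_path_def U_def)
    have finB: "finite B" and finU: "finite U" using B(2) fin by (auto simp: U_def intro: finite_subset)
    have disj: "set p \<inter> U = {}" "set p \<inter> B = {}" "U \<inter> B = {}" "V = set p \<union> U \<union> B"
      using B(2) path(3) by (auto simp: U_def)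
    have "V - set p = B \<union> U" using B(2) by (auto simp: U_def)
    then have aBU: "a = alpha B + alpha U"
      using alpha_Un_apart[OF finB finU _ BU] disj(3) a by (simp add: Int_commute)

    \<comment> \<open>Otherwise the component of \<open>b\<close> in \<open>B\<close> would form a
      smaller candidate with the same path.\<close>
    have B_connected: "\<exists>R. R \<noteq> [] \<and> is_path R \<and> set R \<subseteq> B \<and> hd R = b \<and> last R = b'"
      if "b \<in> B" "b' \<in> B" for b b'
    proof -
      let ?r = "\<lambda>u v. E u v \<and> u \<in> B \<and> v \<in> B"
      define C where "C = {c. ?r\<^sup>*\<^sup>* b c}"
      have "C \<subseteq> B" unfolding C_def using that(1) by (auto elim: rtranclp.cases)
      have "apart C (B - C)"
        using \<open>C \<subseteq> B\<close> unfolding apart_def C_def by (auto intro: rtranclp.rtrancl_into_rtrancl)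
      then have "apart C (V - set p - C)"
        using BU \<open>C \<subseteq> B\<close> unfolding apart_def U_def by blast
      moreover have "b \<in> C" by (simp add: C_def)
      ultimately have "cand (p, C)"
        using cand B(2) \<open>C \<subseteq> B\<close> by (auto simp: cand_def)
      then have "C = B" using min2 card_seteq[OF finB \<open>C \<subseteq> B\<close>] by blast
      then show ?thesis using that path_if_reachable[of B b b'] by (auto simp: C_def)
    qed

    txt \<open>The new path trades part of \<open>B\<close> for vertices that do not raise \<open>\<alpha>(U)\<close>, against the choice
      of \<open>p\<close> and \<open>B\<close>.\<close>
    have no_reroute: False
      if q: "is_path q" "set q \<subseteq> V" and R: "R \<noteq> []" "set R \<subseteq> B" "set q \<inter> B = set R"
        and M: "V - set q \<subseteq> (B - set R) \<union> M" "M \<inter> B = {}" "M \<subseteq> V" "alpha M \<le> alpha U" "apart B M"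
      for q R M
    proof -
      have good: "good q" using q by (simp add: good_def)
      have le: "alpha (V - set q) \<le> alpha (B - set R) + alpha M"
        using alpha_mono[OF _ M(1)] alpha_Un_le[of "B - set R" M] finB M(3) fin
        by (meson finite_Diff finite_UnI finite_subset le_trans)
      have "hd R \<in> B - (B - set R)" using R(1,2) by auto
      then have lt: "card (B - set R) < card B"
        using finB by (intro psubset_card_mono) auto
      \<comment> \<open>If \<open>R\<close> uses up \<open>B\<close>, the value falls below
        \<open>a\<close>, since \<open>alpha B\<close> is positive. Otherwise it stays
        \<open>a\<close>, and what remains of \<open>B\<close> is a smaller candidate than
        \<open>B\<close>.\<close>
      show False
      proof (cases "B - set R = {}")
        case True
        then have "alpha (B - set R) = 0" by (simp only: alpha_empty)
        then show False using le min1[OF good] M(4) aBU alpha_pos[OF finB B(1)] by linarith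
      next
        case False
        have "alpha (B - set R) \<le> alpha B" using finB by (intro alpha_mono) auto
        then have "alpha (V - set q) = a" using le min1[OF good] M(4) aBU by linarith
        moreover have "V - set q - (B - set R) \<subseteq> M" using M(1) by blast
        then have "apart (B - set R) (V - set q - (B - set R))"
          using M(5) by (blast intro: apart_subset)
        moreover have "B - set R \<subseteq> V - set q" using R(3) B(2) by blast
        ultimately have "cand (q, B - set R)" using good False by (simp add: cand_def)
        then show False using min2 lt by fastforce
      qed
    qed

    define n where "n = length p"
    define X where "X = {i. i < n \<and> (\<exists>b\<in>B. E b (p ! i))}"
    define seg where "seg s m = (!) p ` {s..<m}" for s m
    \<comment> \<open>At this point 0 may lie in \<open>X\<close>, and \<open>n\<close> may be a
      start; \<open>ex_end\<close> will imply that every start lies before \<open>n\<close> and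
      outside \<open>X\<close>.\<close>
    define starts where "starts = insert 0 (Suc ` X)"
    have "finite X" by (simp add: X_def)
    have seg_apart: "apart B (seg s m)" if "{s..<m} \<inter> X = {}" "m \<le> n" for s m
      using that unfolding apart_def seg_def X_def by fastforce
    have seg_p: "seg s m \<subseteq> set p" if "m \<le> n" for s m using that by (auto simp: seg_def n_def)
    have seg_inter: "seg s m \<inter> seg s' m' = {}" if "m \<le> s'" "m' \<le> n" for s m s' m'
      using that path(1) by (auto simp: seg_def n_def nth_eq_iff_index_eq)
    have fin_seg: "finite (seg s m)" for s m by (simp add: seg_def)

    have set_seg: "set (drop s (take m p)) = seg s m" if "s \<le> m" "m \<le> n" for s m
    proof -
      have "set (drop s (take m p)) = (\<lambda>i. p ! (s + i)) ` {0..<m - s}"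
        using that by (force simp: set_conv_nth n_def)
      also have "\<dots> = (!) p ` ((+) s ` {0..<m - s})" by (simp only: image_image)
      also have "(+) s ` {0..<m - s} = {s..<m}" using that by simp
      finally show ?thesis by (simp add: seg_def)
    qed

    have last_take: "take s p = [] \<or> E (last (take s p)) v"
      if "s > 0 \<longrightarrow> E (p ! (s - 1)) v" "s \<le> n" for s v
    proof (cases "s = 0")
      case False
      then have "last (take s p) = p ! (s - 1)"
        using that(2) by (subst last_conv_nth) (auto simp: n_def min_def)
      then show ?thesis using that(1) False by simp
    qed simp

    \<comment> \<open>At an end of \<open>p\<close> (\<open>s = 0\<close> or \<open>m = n\<close>)
      there is nothing to attach to, and any vertex of \<open>B\<close> serves as that end of
      \<open>R\<close>.\<close>
    have bridge: "\<exists>R. R \<noteq> [] \<and> is_path R \<and> set R \<subseteq> B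
        \<and> (s > 0 \<longrightarrow> E (p ! (s - 1)) (hd R)) \<and> (m < n \<longrightarrow> E (last R) (p ! m))"
      if s: "s \<in> starts" and m: "m = n \<or> m \<in> X" for s m
    proof -
      obtain b where b: "b \<in> B" "s > 0 \<longrightarrow> E (p ! (s - 1)) b"
        using s B(1) sym unfolding starts_def X_def by fastforce
      obtain b' where b': "b' \<in> B" "m < n \<longrightarrow> E b' (p ! m)"
        using m B(1) unfolding X_def by blast
      show ?thesis using B_connected[OF b(1) b'(1)] b(2) b'(2) by metis
    qed

    have ex_end: "\<exists>m. s \<le> m \<and> m \<le> n \<and> {s..<m} \<inter> X = {} \<and> alpha U < alpha (U \<union> seg s m)"
      if s: "s \<in> starts" for s
    proof -
      have sn: "s \<le> n" using s by (auto simp: starts_def X_def)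
      \<comment> \<open>The next neighbour of \<open>B\<close> at or after \<open>s\<close>, or else
        the end of \<open>p\<close>. If the segment before it did not raise \<open>alpha U\<close>,
        a path through \<open>B\<close> could replace it, contrary to
        \<open>no_reroute\<close>.\<close>
      define m where "m = (LEAST m. s \<le> m \<and> (m = n \<or> m \<in> X))"
      have m: "s \<le> m \<and> (m = n \<or> m \<in> X)" unfolding m_def by (rule LeastI[of _ n]) (use sn in auto)
      have "m \<le> n" using m by (auto simp: X_def)
      have emp: "{s..<m} \<inter> X = {}" unfolding m_def using not_less_Least by fastforce
      show ?thesis
      proof (rule ccontr)
        assume "\<not> ?thesis"
        then have al: "alpha (U \<union> seg s m) \<le> alpha U" using m \<open>m \<le> n\<close> emp by auto
        obtain R where R: "R \<noteq> []" "is_path R" "set R \<subseteq> B"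
            "s > 0 \<longrightarrow> E (p ! (s - 1)) (hd R)" "m < n \<longrightarrow> E (last R) (p ! m)"
          using bridge[OF s] m by blast
        define p1 p2 p3 where "p1 = take s p" and "p2 = drop s (take m p)" and "p3 = drop m p"
        have pp: "p = p1 @ p2 @ p3"
          unfolding p1_def p2_def p3_def using m
          by (metis append_take_drop_id append_assoc min.absorb1 take_take)
        have p1: "p1 = [] \<or> E (last p1) (hd R)" unfolding p1_def by (rule last_take[OF R(4) sn])
        have p3: "p3 = [] \<or> E (last R) (hd p3)"
          using R(5) by (cases "m < n") (auto simp: p3_def n_def hd_drop_conv_nth)
        have p2: "set p2 = seg s m"
          unfolding p2_def using m \<open>m \<le> n\<close> by (intro set_seg) auto
        let ?q = "p1 @ R @ p3"
        show False
        proof (rule no_reroute[of ?q R "U \<union> seg s m"])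
          have "distinct ?q"
            using path(1) disj(2) R(2,3) by (auto simp: pp is_path_def)
          moreover have "successively E p1" "successively E p3"
            using path(2) by (simp_all add: pp successively_append_iff)
          then have "successively E ?q"
            using R(1,2) p1 p3 by (auto simp: is_path_def successively_append_iff)
          ultimately show "is_path ?q" by (simp add: is_path_def)
          show "set ?q \<subseteq> V" "set ?q \<inter> B = set R" "V - set ?q \<subseteq> B - set R \<union> (U \<union> seg s m)"
            using pp disj R(3) p2[symmetric] by auto
          show "(U \<union> seg s m) \<inter> B = {}" "U \<union> seg s m \<subseteq> V"
            using disj seg_p[OF \<open>m \<le> n\<close>, of s] by auto
          show "apart B (U \<union> seg s m)" using BU seg_apart[OF emp \<open>m \<le> n\<close>] by (auto simp: apart_def)
        qed (use R al in auto)
      qed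
    qed

    \<comment> \<open>The end is chosen least so that leaving out a proper initial piece of a
      segment does not raise \<open>alpha U\<close>, as rerouting requires.\<close>
    define e where "e s = (LEAST m. s \<le> m \<and> m \<le> n \<and> alpha U < alpha (U \<union> seg s m))" for s
    have e: "s \<le> e s" "e s \<le> n" "alpha U < alpha (U \<union> seg s (e s))" "{s..<e s} \<inter> X = {}" "s < e s"
      if s: "s \<in> starts" for s
    proof -
      obtain m where m: "s \<le> m \<and> m \<le> n \<and> alpha U < alpha (U \<union> seg s m)" "{s..<m} \<inter> X = {}"
        using ex_end[OF s] by blast
      show e: "s \<le> e s" "e s \<le> n" "alpha U < alpha (U \<union> seg s (e s))"
        using LeastI[of "\<lambda>m. s \<le> m \<and> m \<le> n \<and> alpha U < alpha (U \<union> seg s m)", OF m(1)] by (auto simp: e_def)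
      have "e s \<le> m" unfolding e_def
        by (rule Least_le[of "\<lambda>m. s \<le> m \<and> m \<le> n \<and> alpha U < alpha (U \<union> seg s m)", OF m(1)])
      then show "{s..<e s} \<inter> X = {}" using m(2) by fastforce
      show "s < e s" using e by (cases "s = e s") (auto simp: seg_def)
    qed
    have before_e: "alpha (U \<union> seg s m) \<le> alpha U" if "s \<in> starts" "s \<le> m" "m < e s" for s m
      using not_less_Least[of m "\<lambda>m. s \<le> m \<and> m \<le> n \<and> alpha U < alpha (U \<union> seg s m)"] that e(2)[OF that(1)]
      by (auto simp: e_def)
    \<comment> \<open>The vertex just before a start other than 0 is a neighbour of
      \<open>B\<close>, and no segment contains such a vertex.\<close>
    have e_less: "e s < s'" if "s \<in> starts" "s' \<in> starts" "s < s'" for s s'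
    proof -
      have "s' \<in> Suc ` X" using that(2,3) by (simp add: starts_def)
      then obtain x where x: "x \<in> X" "s' = Suc x" by blast
      then have "x \<notin> {s..<e s}" using e(4)[OF that(1)] by blast
      then show ?thesis using x that(3) by auto
    qed

    txt \<open>By the choice of a linked pair \<open>(j, j')\<close> with \<open>j + j'\<close> minimal, the two parts of \<open>p\<close> bypassed by
      the new path are not linked, so \<open>alpha_modular\<close> applies to them.\<close>
    have unlinked: "\<not> linked U (p ! j) (p ! j')"
      if s: "s \<in> starts" "s' \<in> starts" "s < s'" and "s \<le> j" "j < e s" "s' \<le> j'" "j' < e s'" for s s' j j'
      using that(4-7)
    proof (induction "j + j'" arbitrary: j j' rule: less_induct)
      case less
      show ?case
      proof
        assume "linked U (p ! j) (p ! j')"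
        then obtain R' where R': "distinct R'" "set R' \<subseteq> U" "successively E (p ! j # R' @ [p ! j'])"
          unfolding linked_def by blast
        have js': "j < s'" "j' < n" using less.prems e_less[OF s] e(2)[OF s(2)] by auto
        have "s' \<in> Suc ` X" using s(2,3) by (simp add: starts_def)
        then obtain x where x: "x \<in> X" "s' = Suc x" by blast
        have "x < n" using x by (simp add: X_def)
        obtain R where R: "R \<noteq> []" "is_path R" "set R \<subseteq> B"
            "s > 0 \<longrightarrow> E (p ! (s - 1)) (hd R)" "E (last R) (p ! x)"
          using bridge[OF s(1), of x] x(1) \<open>x < n\<close> by blast
        define p1 p2 p3 p4 p5 where "p1 = take s p" and "p2 = drop s (take j p)"
          and "p3 = drop j (take s' p)" and "p4 = drop s' (take j' p)" and "p5 = drop j' p"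
        have pp: "p = p1 @ p2 @ p3 @ p4 @ p5"
          unfolding p1_def p2_def p3_def p4_def p5_def using less.prems js'
          by (smt (verit, ccfv_threshold) append_take_drop_id append_assoc min.absorb1 take_take nat_less_le)
        have p1: "p1 = [] \<or> E (last p1) (hd R)"
          unfolding p1_def using less.prems js' e(2)[OF s(1)] by (intro last_take[OF R(4)]) auto
        have p3: "p3 \<noteq> []" "hd p3 = p ! j" "last p3 = p ! x"
          using less.prems js' x \<open>x < n\<close> by (auto simp: p3_def n_def hd_drop_conv_nth last_conv_nth min_def)
        have p5: "p5 \<noteq> []" "hd p5 = p ! j'"
          using js' by (auto simp: p5_def n_def hd_drop_conv_nth)
        have p2: "set p2 = seg s j" and p4: "set p4 = seg s' j'"
          unfolding p2_def p4_def using less.prems js' e(2)[OF s(1)] by (auto intro!: set_seg)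
        have "is_path p3" using path pp by (simp add: is_path_def successively_append_iff)
        then have rev3: "is_path (rev p3)" by (rule is_path_rev)
        \<comment> \<open>The route follows \<open>p\<close> to just before \<open>s\<close>,
          crosses \<open>B\<close> to \<open>x\<close> (just before \<open>s'\<close>), runs back
          along \<open>p\<close> to \<open>j\<close>, crosses \<open>U\<close> to \<open>j'\<close>,
          and follows \<open>p\<close> to its end. On \<open>p\<close> it omits only the pieces from
          \<open>s\<close> to before \<open>j\<close> and from \<open>s'\<close> to before
          \<open>j'\<close>.\<close>
        let ?q = "p1 @ R @ rev p3 @ R' @ p5"
        let ?M = "U \<union> seg s j \<union> seg s' j'"
        have jn: "j \<le> n" "j' \<le> n" using js' less.prems e(2)[OF s(1)] by auto
        have "alpha ?M + alpha U = alpha (U \<union> seg s j) + alpha (U \<union> seg s' j')"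
        proof (rule alpha_modular)
          show "seg s j \<inter> U = {}" "seg s' j' \<inter> U = {}" using disj seg_p jn by blast+
          show "seg s j \<inter> seg s' j' = {}" using js' by (intro seg_inter) auto
          fix u v assume "u \<in> seg s j" "v \<in> seg s' j'"
          then obtain i i' where "s \<le> i" "i < j" "u = p ! i" "s' \<le> i'" "i' < j'" "v = p ! i'"
            by (auto simp: seg_def)
          then show "\<not> linked U u v" using less.hyps[of i i'] less.prems by auto
        qed (use finU fin_seg in auto)
        then have al: "alpha ?M \<le> alpha U"
          using before_e[OF s(1) less.prems(1,2)] before_e[OF s(2) less.prems(3,4)] by linarith
        have "{s..<j} \<inter> X = {}" "{s'..<j'} \<inter> X = {}"
          using e(4)[OF s(1)] e(4)[OF s(2)] less.prems by fastforce+
        then have ap: "apart B ?M" using BU seg_apart jn unfolding apart_def by blast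
        show False
        proof (rule no_reroute[of ?q R ?M])
          have "successively E p1" "successively E p5"
            using path(2) by (simp_all add: pp successively_append_iff)
          have "successively E (rev p3 @ R' @ p5)"
            using rev3 R'(3) p3 p5 \<open>successively E p5\<close>
            by (cases R' rule: rev_cases)
              (auto simp: is_path_def successively_append_iff successively_Cons last_rev hd_append)
          then have "successively E ?q"
            using R(1,2,5) p1 p3 \<open>successively E p1\<close>
            by (auto simp: is_path_def successively_append_iff hd_append hd_rev)
          moreover have "distinct ?q"
            using path(1) R(2,3) R'(1,2) disj(1-3) by (auto simp: pp is_path_def)
          ultimately show "is_path ?q" by (simp add: is_path_def)
          show "set ?q \<subseteq> V" "set ?q \<inter> B = set R" "V - set ?q \<subseteq> B - set R \<union> ?M"
            using pp disj R(3) R'(2) p2[symmetric] p4[symmetric] by auto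
          show "?M \<inter> B = {}" "?M \<subseteq> V"
            using disj seg_p[of j s] seg_p[of j' s'] jn by auto
        qed (use R al ap in auto)
      qed
    qed

    have fin_starts: "finite starts" and card_starts: "card starts = card X + 1"
      using \<open>finite X\<close> by (auto simp: starts_def card_image)
    have ge: "alpha U + card starts \<le> alpha (U \<union> (\<Union>s\<in>starts. seg s (e s)))"
    proof (rule alpha_unlinked_family)
      show "seg s (e s) \<inter> U = {}" if "s \<in> starts" for s using seg_p[OF e(2)] disj that by blast
      fix s t assume st: "s \<in> starts" "t \<in> starts" "s \<noteq> t"
      show "seg s (e s) \<inter> seg t (e t) = {}"
        using st e_less[of s t] e_less[of t s] e(2) seg_inter[of "e s" t "e t" s] seg_inter[of "e t" s "e s" t]
        by (cases s t rule: linorder_cases) auto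
      fix u v assume "u \<in> seg s (e s)" "v \<in> seg t (e t)"
      then obtain i j where "s \<le> i" "i < e s" "u = p ! i" "t \<le> j" "j < e t" "v = p ! j"
        by (auto simp: seg_def)
      then show "\<not> linked U u v"
        using st unlinked[of s t i j] unlinked[of t s j i] linked_commute[of U u v]
        by (cases s t rule: linorder_cases) auto
    qed (use fin_starts finU fin_seg e(3) in auto)

    \<comment> \<open>The neighbours of \<open>B\<close> on \<open>p\<close> separate
      \<open>B\<close> from the rest, which is nonempty because \<open>p ! 0\<close> is not among
      them.\<close>
    have "k \<le> card (V - B - (V - B - (!) p ` X))"
    proof (rule conn)
      have "0 \<in> starts" by (simp add: starts_def)
      then have "0 < e 0" "e 0 \<le> n" "0 \<notin> X" using e(2,4,5)[of 0] by auto
      moreover from this have "0 < length p" unfolding n_def by linarith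
      ultimately have "p ! 0 \<in> set p" "p ! 0 \<notin> (!) p ` X"
        using path(1) by (auto simp: n_def X_def nth_eq_iff_index_eq)
      then show "V - B - (!) p ` X \<noteq> {}" using disj by blast
      show "apart B (V - B - (!) p ` X)"
        unfolding apart_def
      proof (intro ballI notI)
        fix b v assume bv: "b \<in> B" "v \<in> V - B - (!) p ` X" "E b v"
        then have "v \<in> set p" using BU by (auto simp: U_def apart_def)
        then obtain i where "i < n" "v = p ! i" by (auto simp: in_set_conv_nth n_def)
        then show False using bv by (auto simp: X_def)
      qed
    qed (use B in auto)
    also have "\<dots> \<le> card ((!) p ` X)" using \<open>finite X\<close> by (intro card_mono) auto
    also have "\<dots> \<le> card X" using \<open>finite X\<close> by (rule card_image_le)
    finally have kX: "k \<le> card X" .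

    let ?W = "U \<union> (\<Union>s\<in>starts. seg s (e s))"
    have W: "?W \<subseteq> U \<union> set p" using seg_p e(2) by blast
    \<comment> \<open>The segments avoid the neighbours of \<open>B\<close>, so
      \<open>alpha B\<close> adds to their increments. With \<open>a = alpha B + alpha U\<close>
      this gives \<open>alpha V\<close> at least \<open>a + card X + 1\<close>.\<close>
    have "alpha (B \<union> ?W) = alpha B + alpha ?W"
    proof (rule alpha_Un_apart)
      show "apart B ?W" using BU seg_apart e(2,4) unfolding apart_def by blast
      show "B \<inter> ?W = {}" using W disj by blast
    qed (use finB finU fin_starts fin_seg in auto)
    moreover have "alpha (B \<union> ?W) \<le> alpha V" using W disj by (intro alpha_mono fin) auto
    ultimately have "alpha (V - set p) \<le> alpha V - (k + 1)"
      using ge card_starts kX a aBU by linarith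
    then show thesis using that[of p] path by (simp add: is_path_def)
  qed
qed

section \<open>From a path to parents\<close>

lemma hamiltonian_after_completing_path:
  assumes fin: "finite V" and "V \<noteq> {}"
    and conn: "\<And>A B. A \<subseteq> V \<Longrightarrow> B \<subseteq> V \<Longrightarrow> A \<noteq> {} \<Longrightarrow> B \<noteq> {} \<Longrightarrow> A \<inter> B = {} \<Longrightarrow> apart A B
      \<Longrightarrow> k \<le> card (V - A - B)"
    and alpha: "alpha V \<le> 2 * k + 1"
  obtains p q where "p \<noteq> []" "is_path p" "set p \<subseteq> V" "distinct q" "set q = V"
    "successively (\<lambda>u v. E u v \<or> u \<in> set p \<and> v \<in> set p) q"
proof -
  obtain p0 where p0: "is_path p0" "set p0 \<subseteq> V" "alpha (V - set p0) \<le> alpha V - (k + 1)"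
    by (rule path_dropping_independence[OF fin conn])
  obtain v0 where v0: "v0 \<in> V" using \<open>V \<noteq> {}\<close> by blast
  \<comment> \<open>The first vertex of \<open>p\<close> will be the root of the tree, so
    \<open>p\<close> must be nonempty; enlarging it cannot raise the independence number of the
    rest.\<close>
  define p where "p = (if p0 = [] then [v0] else p0)"
  have p: "p \<noteq> []" "is_path p" "set p \<subseteq> V"
    using p0(1,2) v0 by (auto simp: p_def is_path_def)
  have "alpha (V - set p) \<le> alpha (V - set p0)"
    using fin by (intro alpha_mono) (auto simp: p_def)
  then have alpha_rest: "alpha (V - set p) \<le> k" using p0(3) alpha by linarith
  define E' where "E' u v \<longleftrightarrow> E u v \<or> u \<noteq> v \<and> u \<in> set p \<and> v \<in> set p" for u v
  interpret C: adjacency E'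
    by unfold_locales (auto simp: E'_def sym irrefl)
  \<comment> \<open>An independent set of the new graph contains at most one vertex of the clique on
    \<open>p\<close>.\<close>
  have C_alpha: "C.alpha V \<le> k + 1"
  proof -
    obtain I where I: "I \<subseteq> V" "C.indep I" "card I = C.alpha V"
      using C.alpha_attained[OF fin] by blast
    have "finite I" using I(1) fin finite_subset by blast
    have "card I \<le> card (I \<inter> set p) + card (I - set p)"
      using card_Un_le[of "I \<inter> set p" "I - set p"] by (simp add: Int_Diff_Un)
    moreover have "card (I \<inter> set p) \<le> 1"
      using I(2) \<open>finite I\<close> by (auto simp: card_le_Suc0_iff_eq C.indep_def E'_def)
    moreover have "indep (I - set p)" using I(2) by (auto simp: C.indep_def indep_def E'_def)
    then have "card (I - set p) \<le> alpha (V - set p)"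
      using I(1) fin by (intro card_le_alpha) auto
    ultimately show ?thesis using alpha_rest I(3) by linarith
  qed
  \<comment> \<open>With more edges fewer pairs of sets are apart, so the bound on separators is
    inherited.\<close>
  have C_conn: "k \<le> card (V - A - B)"
    if "A \<subseteq> V" "B \<subseteq> V" "A \<noteq> {}" "B \<noteq> {}" "A \<inter> B = {}" "C.apart A B" for A B
    using that by (intro conn) (auto simp: C.apart_def apart_def E'_def)
  obtain q where q: "C.is_path q" "set q \<subseteq> V" "C.alpha (V - set q) \<le> C.alpha V - (k + 1)"
    by (rule C.path_dropping_independence[OF fin C_conn])
  then have "C.alpha (V - set q) = 0" using C_alpha by linarith
  then have "V - set q = {}" using C.alpha_pos[of "V - set q"] fin by auto
  then have "set q = V" using q(2) by blast
  moreover have "successively (\<lambda>u v. E u v \<or> u \<in> set p \<and> v \<in> set p) q"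
    using q(1) by (auto simp: C.is_path_def E'_def elim: successively_mono)
  moreover have "distinct q" using q(1) by (simp add: C.is_path_def)
  ultimately show thesis using p that[of p q] by blast
qed

end

section \<open>Indices in a duplicate-free list\<close>

definition position :: "'a list \<Rightarrow> 'a \<Rightarrow> nat" where
  "position xs = the_inv_into {..<length xs} ((!) xs)"

lemma position_nth [simp]:
  assumes "distinct xs" "i < length xs"
  shows "position xs (xs ! i) = i"
  unfolding position_def using assms by (intro the_inv_into_f_f) (auto intro: inj_on_nth)

lemma position_less:
  assumes "distinct xs" "x \<in> set xs"
  shows "position xs x < length xs"
  using assms by (metis in_set_conv_nth position_nth)

lemma nth_position:
  assumes "distinct xs" "x \<in> set xs"
  shows "xs ! position xs x = x"
  using assms by (metis in_set_conv_nth position_nth)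

context adjacency
begin

text \<open>The caterpillar is encoded by parents, with root \<open>hd p\<close>. The decreasing
  \<open>rank\<close> will exclude cycles and lead every vertex to the root. The last property
  leaves a vertex off \<open>p\<close> at most one child, hence degree at most two.\<close>

lemma caterpillar_parents:
  assumes p: "p \<noteq> []" "is_path p" "set p \<subseteq> V" and q: "distinct q" "set q = V"
    and succ: "successively (\<lambda>u v. E u v \<or> u \<in> set p \<and> v \<in> set p) q"
  obtains par :: "'a \<Rightarrow> 'a" and rank :: "'a \<Rightarrow> nat"
  where "\<And>v. v \<in> V \<Longrightarrow> v \<noteq> hd p \<Longrightarrow> par v \<in> V \<and> E v (par v) \<and> rank (par v) < rank v"
    and "successively (\<lambda>u v. v \<noteq> hd p \<and> par v = u) p"
    and "\<And>v w. v \<in> V - {hd p} \<Longrightarrow> w \<in> V - {hd p} \<Longrightarrow> par v = par w \<Longrightarrow> par v \<notin> set p \<Longrightarrow> v = w"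
proof -
  have dp: "distinct p" using p(2) by (simp add: is_path_def)
  have "hd p \<in> set q" using p q by auto
  define x where "x = position q (hd p)"
  have x: "x < length q" "q ! x = hd p"
    using position_less[OF q(1) \<open>hd p \<in> set q\<close>] nth_position[OF q(1) \<open>hd p \<in> set q\<close>]
    by (auto simp: x_def)
  txt \<open>A vertex outside \<open>p\<close> has its parent next to it on \<open>q\<close>, in the direction of the position \<open>x\<close> of a
    vertex of \<open>p\<close>.\<close>
  define qi where "qi v = (if x < position q v then position q v - 1 else position q v + 1)" for v
  define par where "par v = (if v \<in> set p then p ! (position p v - 1) else q ! qi v)" for v
  \<comment> \<open>Off \<open>p\<close> one of the truncated differences vanishes, so their sum is
    the distance from \<open>x\<close> along \<open>q\<close>; the summand \<open>length p\<close>
    puts these ranks above all ranks on \<open>p\<close>.\<close>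
  define rank where "rank v = (if v \<in> set p then position p v
      else length p + (position q v - x) + (x - position q v))" for v
  have leg: "par v = q ! qi v" "qi v < length q" "E v (par v)" "rank (par v) < rank v"
    "position q v \<noteq> x" "position q v < length q" "q ! position q v = v"
    if v: "v \<in> V" "v \<notin> set p" for v
  proof -
    show 1: "par v = q ! qi v" using v by (simp add: par_def)
    show i: "position q v < length q" "q ! position q v = v"
      using v(1) q(2) position_less[OF q(1)] nth_position[OF q(1)] by simp_all
    have "v \<noteq> hd p" using v p(1) by auto
    then show ne: "position q v \<noteq> x" using x i by auto
    show 2: "qi v < length q" using i x ne by (auto simp: qi_def)
    have step: "E (q ! i) (q ! Suc i) \<or> q ! i \<in> set p \<and> q ! Suc i \<in> set p" if "Suc i < length q" for i
      using succ that by (auto simp: successively_conv_nth)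
    \<comment> \<open>As \<open>v\<close> is not on \<open>p\<close>, a step of \<open>q\<close> at
      \<open>v\<close> cannot be one of the added pairs and is an original edge.\<close>
    show "E v (par v)"
    proof (cases "x < position q v")
      case True
      then have "E (q ! (position q v - 1)) (q ! position q v)"
        using step[of "position q v - 1"] i v by auto
      then have "E (q ! position q v) (q ! (position q v - 1))" by (rule sym)
      then show ?thesis using True i unfolding 1 qi_def by simp
    next
      case False
      then have "E (q ! position q v) (q ! Suc (position q v))"
        using step[of "position q v"] i v x ne by auto
      then show ?thesis using False i unfolding 1 qi_def by auto
    qed
    show "rank (par v) < rank v"
    proof (cases "par v \<in> set p")
      case True
      then have "rank (par v) < length p" using dp position_less by (simp add: rank_def)
      then show ?thesis using v by (simp add: rank_def)
    next
      case False
      have "position q (par v) = qi v" using 2 q(1) by (simp add: 1)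
      then show ?thesis using False v ne by (auto simp: rank_def qi_def)
    qed
  qed
  have spine: "par (p ! Suc i) = p ! i" "E (p ! Suc i) (p ! i)" if "Suc i < length p" for i
  proof -
    show "par (p ! Suc i) = p ! i" using that dp by (simp add: par_def)
    have "E (p ! i) (p ! Suc i)" using that p(2) by (simp add: is_path_def successively_conv_nth)
    then show "E (p ! Suc i) (p ! i)" by (rule sym)
  qed
  have spine_ex: "\<exists>i. Suc i < length p \<and> v = p ! Suc i" if v: "v \<in> set p" "v \<noteq> hd p" for v
  proof -
    obtain j where j: "j < length p" "v = p ! j" using v(1) by (metis in_set_conv_nth)
    have "j \<noteq> 0"
    proof
      assume "j = 0"
      then have "v = hd p" using j(2) hd_conv_nth[OF p(1)] by simp
      then show False using v(2) by contradiction
    qed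
    then obtain i where "j = Suc i" using not0_implies_Suc by blast
    then show ?thesis using j by blast
  qed
  show thesis
  proof
    fix v assume v: "v \<in> V" "v \<noteq> hd p"
    show "par v \<in> V \<and> E v (par v) \<and> rank (par v) < rank v"
    proof (cases "v \<in> set p")
      case True
      then obtain i where i: "Suc i < length p" "v = p ! Suc i" using spine_ex v by blast
      then show ?thesis using spine[OF i(1)] p(3) dp by (auto simp: rank_def)
    next
      case False
      have "q ! qi v \<in> V" using leg(2)[OF v(1) False] q(2) by auto
      then show ?thesis using leg(1-4)[OF v(1) False] by simp
    qed
  next
    show "successively (\<lambda>u v. v \<noteq> hd p \<and> par v = u) p"
      using spine dp p(1) by (auto simp: successively_conv_nth hd_conv_nth nth_eq_iff_index_eq)
  next
    fix v w assume vw: "v \<in> V - {hd p}" "w \<in> V - {hd p}" "par v = par w" "par v \<notin> set p"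
    have np: "u \<notin> set p" if "u \<in> V - {hd p}" "par u \<notin> set p" for u
      using that spine_ex[of u] spine(1) by (metis Diff_iff Suc_lessD nth_mem singletonI)
    have "v \<notin> set p" "w \<notin> set p" using np[of v] np[of w] vw by auto
    note v = leg[OF _ this(1)] and w = leg[OF _ this(2)]
    have "qi v = qi w"
      using vw v(1,2) w(1,2) q(1) by (auto simp: nth_eq_iff_index_eq)
    \<comment> \<open>Vertices on different sides of \<open>x\<close> can share a parent only at
      position \<open>x\<close>, which holds \<open>hd p\<close>; on one side the parent determines
      the child.\<close>
    moreover have "qi v \<noteq> x"
    proof
      assume "qi v = x"
      then have "par v = hd p" using vw v(1) x by auto
      then show False using vw(4) p(1) by simp
    qed
    ultimately have "position q v = position q w"
      using v(5) w(5) vw by (auto simp: qi_def split: if_splits)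
    then show "v = w" using v(7) w(7) vw by (metis DiffD1)
  qed
qed

end

section \<open>Translation to digraphs\<close>

text \<open>A walk starting in \<open>A\<close> never leaves it. Since \<open>connected\<close>
  refers to the symmetric closure, arcs must be excluded in both directions.\<close>

lemma connected_no_separation:
  assumes "connected H" "A \<subseteq> verts H" "A \<noteq> {}"
    and closed: "\<And>u v. u \<in> A \<Longrightarrow> v \<in> verts H - A \<Longrightarrow> \<not> u \<rightarrow>\<^bsub>H\<^esub> v \<and> \<not> v \<rightarrow>\<^bsub>H\<^esub> u"
  shows "A = verts H"
proof -
  obtain a where a: "a \<in> A" using assms(3) by blast
  have "v \<in> A" if v: "v \<in> verts H" for v
  proof -
    have "a \<rightarrow>\<^sup>*\<^bsub>with_proj (mk_symmetric H)\<^esub> v"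
      using assms(1,2) a v by (auto simp: connected_def strongly_connected_def)
    then have "(a, v) \<in> rtrancl_on (verts H) (parcs (mk_symmetric H))"
      by (simp add: reachable_def)
    then show ?thesis
    proof (induction rule: rtrancl_on_induct)
      case (step y z)
      then have "y \<rightarrow>\<^bsub>H\<^esub> z \<or> z \<rightarrow>\<^bsub>H\<^esub> y"
        by (auto simp: parcs_mk_symmetric arcs_ends_conv)
      then show ?case using closed[of y z] step by blast
    qed (rule a)
  qed
  then show ?thesis using assms(2) by blast
qed

text \<open>Removing the vertices outside \<open>A \<union> B\<close> disconnects the graph, so
  their number is among those minimised over.\<close>

lemma vertex_connectivity_le:
  assumes "finite (verts G)" and A: "A \<subseteq> verts G" "A \<noteq> {}" and B: "B \<subseteq> verts G" "B \<noteq> {}"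
    and "A \<inter> B = {}" and no_arc: "\<And>u v. u \<in> A \<Longrightarrow> v \<in> B \<Longrightarrow> \<not> u \<rightarrow>\<^bsub>G\<^esub> v \<and> \<not> v \<rightarrow>\<^bsub>G\<^esub> u"
  shows "vertex_connectivity G \<le> card (verts G - A - B)"
proof -
  let ?S = "verts G - A - B"
  let ?H = "G \<restriction> (verts G - ?S)"
  have "\<not> connected ?H"
  proof
    assume "connected ?H"
    moreover have rest: "verts G - ?S = A \<union> B" using A B by blast
    have "\<not> u \<rightarrow>\<^bsub>?H\<^esub> v \<and> \<not> v \<rightarrow>\<^bsub>?H\<^esub> u" if "u \<in> A" "v \<in> verts ?H - A" for u v
      using that no_arc[of u v] rest by (auto dest: dominates_induce_subgraphD)
    ultimately have "A = verts ?H"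
      using A(2) rest by (intro connected_no_separation) auto
    then show False using rest B(2) assms(6) by auto
  qed
  moreover have "?S \<subset> verts G" using A by blast
  ultimately have "card ?S \<in> {card S | S. S \<subset> verts G \<and>
       (\<not> connected (G \<restriction> (verts G - S)) \<or> card (verts G - S) = 1)}"
    by blast
  moreover have "finite {card S | S. S \<subset> verts G \<and>
       (\<not> connected (G \<restriction> (verts G - S)) \<or> card (verts G - S) = 1)}"
  proof (rule finite_subset)
    show "finite (card ` Pow (verts G))" using assms(1) by simp
  qed auto
  ultimately show ?thesis unfolding vertex_connectivity_def by (intro Min_le)
qed

section \<open>Trees and caterpillars from parent functions\<close>

lemma set_vwalk_arcs_subset:
  "successively (\<lambda>u v. (u, v) \<in> A) p \<Longrightarrow> set (vwalk_arcs p) \<subseteq> A"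
  by (induction p rule: vwalk_arcs.induct) auto

context pre_digraph
begin

lemma cas_head_eq_tail:
  "cas u c v \<Longrightarrow> Suc i < length c \<Longrightarrow> head G (c ! i) = tail G (c ! Suc i)"
proof (induction c arbitrary: u i)
  case (Cons e c)
  then show ?case by (cases c; cases i) auto
qed simp

lemma cas_head_last: "cas u c v \<Longrightarrow> c \<noteq> [] \<Longrightarrow> head G (last c) = v"
  by (induction c arbitrary: u) auto

text \<open>A vertex of maximal rank on a cycle would have two distinct neighbours of smaller or
  equal rank, but only its parent qualifies.\<close>
lemma no_cycle_if_parents:
  assumes arcs: "\<And>e. e \<in> arcs G \<Longrightarrow>
      (par (tail G e) = head G e \<and> rank (head G e) < (rank (tail G e) :: nat)) \<or>
      (par (head G e) = tail G e \<and> rank (tail G e) < rank (head G e))"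
    and cycle: "cycle c"
  shows "length c < 3"
proof (rule ccontr)
  assume "\<not> length c < 3"
  define n where "n = length c"
  have n3: "3 \<le> n" using \<open>\<not> length c < 3\<close> by (simp add: n_def)
  obtain u where u: "awalk u c u" "distinct (tl (awalk_verts u c))" "c \<noteq> []"
    using cycle unfolding cycle_def by blast
  have cas: "cas u c u" and sub: "set c \<subseteq> arcs G" using u(1) by (auto simp: awalk_def)
  have dist: "distinct (map (head G) c)"
    using u(2,3) awalk_verts_conv'[OF cas] by simp
  \<comment> \<open>The heads list each vertex of the closed walk once, whereas
    \<open>awalk_verts\<close> repeats \<open>u\<close> at its end.\<close>
  define h where "h i = head G (c ! i)" for i
  have h_inj: "i = j" if "h i = h j" "i < n" "j < n" for i j
    using dist that by (auto simp: h_def n_def distinct_conv_nth)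
  have "{..<n} \<noteq> {}" using n3 by (auto simp: lessThan_empty_iff)
  then obtain i where i: "i < n" "\<And>j. j < n \<Longrightarrow> rank (h j) \<le> rank (h i)"
    using finite_imageI[of "{..<n}" "\<lambda>j. rank (h j)"] obtains_MAX[of "{..<n}" "\<lambda>j. rank (h j)"]
    by (metis Max_ge finite_lessThan imageI lessThan_iff)
  \<comment> \<open>Cyclic neighbours of \<open>i\<close>: arc \<open>c ! i\<close> runs from
    \<open>h prev_i\<close> to \<open>h i\<close>, and arc \<open>c ! next_i\<close> from
    \<open>h i\<close> to \<open>h next_i\<close>.\<close>
  define next_i where "next_i = (if Suc i = n then 0 else Suc i)"
  define prev_i where "prev_i = (if i = 0 then n - 1 else i - 1)"
  have lt: "next_i < n" "prev_i < n" using i(1) by (auto simp: next_i_def prev_i_def)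
  have first: "tail G (c ! 0) = h (n - 1)"
    using cas cas_head_last[OF cas u(3)] u(3) by (cases c) (auto simp: h_def n_def last_conv_nth)
  have next_eq: "tail G (c ! next_i) = h i"
  proof (cases "Suc i = n")
    case True
    then have "n - 1 = i" by simp
    then show ?thesis using first True by (simp add: next_i_def)
  next
    case False
    then show ?thesis
      using cas_head_eq_tail[OF cas, of i] i(1) by (simp add: next_i_def h_def n_def)
  qed
  have prev_eq: "tail G (c ! i) = h prev_i"
    using first cas_head_eq_tail[OF cas, of "i - 1"] i(1)
    by (auto simp: prev_i_def h_def n_def)
  have in_arcs: "c ! j \<in> arcs G" if "j < n" for j using sub that by (auto simp: n_def)
  \<comment> \<open>Maximality of the rank of \<open>h i\<close> excludes the case that
    \<open>h i\<close> is the parent.\<close>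
  have "par (h i) = h next_i"
    using arcs[OF in_arcs[OF lt(1)]] i(2)[OF lt(1)] next_eq by (auto simp: h_def)
  moreover have "par (h i) = h prev_i"
    using arcs[OF in_arcs[OF i(1)]] i(2)[OF lt(2)] prev_eq by (auto simp: h_def)
  ultimately have "next_i = prev_i" using h_inj lt by simp
  then show False using n3 i(1) by (auto simp: next_i_def prev_i_def split: if_splits)
qed

end

text \<open>The condition is symmetric in the two ends, so both arcs of an edge are kept. The value
  of \<open>par\<close> at the root \<open>r\<close> is arbitrary and must be ignored.\<close>

definition parent_graph :: "('a, 'b) pre_digraph \<Rightarrow> 'a \<Rightarrow> ('a \<Rightarrow> 'a) \<Rightarrow> ('a, 'b) pre_digraph" where
  "parent_graph G r par = G\<lparr>arcs := {e \<in> arcs G.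
     (tail G e \<noteq> r \<and> par (tail G e) = head G e) \<or> (head G e \<noteq> r \<and> par (head G e) = tail G e)}\<rparr>"

lemma parent_graph_simps [simp]:
  "verts (parent_graph G r par) = verts G"
  "tail (parent_graph G r par) = tail G"
  "head (parent_graph G r par) = head G"
  "arcs (parent_graph G r par) = {e \<in> arcs G.
     (tail G e \<noteq> r \<and> par (tail G e) = head G e) \<or> (head G e \<noteq> r \<and> par (head G e) = tail G e)}"
  by (simp_all add: parent_graph_def)

text \<open>Following parents lowers \<open>rank\<close> until the root is reached, which gives
  connectedness; \<open>no_cycle_if_parents\<close> gives acyclicity. By \<open>spine\<close> the
  list \<open>p\<close> is a path of the tree, and \<open>legs\<close> bounds the degrees off
  it.\<close>

lemma spanning_caterpillar_if_parents:
  fixes G :: "('a, 'b) pre_digraph" and rank :: "'a \<Rightarrow> nat"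
  assumes "graph G" and p: "p \<noteq> []" "distinct p" "set p \<subseteq> verts G"
    and par: "\<And>v. v \<in> verts G \<Longrightarrow> v \<noteq> hd p \<Longrightarrow>
      par v \<in> verts G \<and> v \<rightarrow>\<^bsub>G\<^esub> par v \<and> rank (par v) < rank v"
    and spine: "successively (\<lambda>u v. v \<noteq> hd p \<and> par v = u) p"
    and legs: "\<And>v w. v \<in> verts G - {hd p} \<Longrightarrow> w \<in> verts G - {hd p} \<Longrightarrow> par v = par w \<Longrightarrow>
      par v \<notin> set p \<Longrightarrow> v = w"
  shows "\<exists>T. spanning_generalized_caterpillar T G"
proof -
  interpret graph G by fact
  define T where "T = parent_graph G (hd p) par"
  have T_simps [simp]: "verts T = verts G" "tail T = tail G" "head T = head G"
    "arcs T = {e \<in> arcs G. (tail G e \<noteq> hd p \<and> par (tail G e) = head G e)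
      \<or> (head G e \<noteq> hd p \<and> par (head G e) = tail G e)}"
    by (simp_all add: T_def)
  have sym_T: "symmetric T"
    using sym_arcs unfolding symmetric_conv by fastforce
  interpret T: graph T
  proof (unfold_locales)
    show "e1 = e2" if "e1 \<in> arcs T" "e2 \<in> arcs T" "arc_to_ends T e1 = arc_to_ends T e2" for e1 e2
      using that no_multi_arcs[of e1 e2] by (simp add: arc_to_ends_def)
  qed (use sym_T no_loops in auto)
  have T_arc: "u \<rightarrow>\<^bsub>T\<^esub> v \<longleftrightarrow> u \<rightarrow>\<^bsub>G\<^esub> v \<and> (u \<noteq> hd p \<and> par u = v \<or> v \<noteq> hd p \<and> par v = u)" for u v
    by (auto simp: arcs_ends_conv)
  have to_parent: "v \<rightarrow>\<^bsub>T\<^esub> par v" if "v \<in> verts G" "v \<noteq> hd p" for v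
    using par[OF that] that by (simp add: T_arc)
  have root: "v \<rightarrow>\<^sup>*\<^bsub>T\<^esub> hd p" if "v \<in> verts G" for v
    using that
  proof (induction "rank v" arbitrary: v rule: less_induct)
    case less
    show ?case
    proof (cases "v = hd p")
      case True
      then show ?thesis using less.prems by auto
    next
      case False
      then have "par v \<rightarrow>\<^sup>*\<^bsub>T\<^esub> hd p" using less par by blast
      then show ?thesis using T.adj_reachable_trans[OF to_parent] less.prems False by blast
    qed
  qed
  have "connected T"
  proof (rule T.connectedI)
    show "verts T \<noteq> {}" using p by auto
    fix u v assume "u \<in> verts T" "v \<in> verts T"
    then have "u \<rightarrow>\<^sup>*\<^bsub>T\<^esub> v"
      using root T.reachable_trans symmetric_reachable[OF sym_T] by (metis T_simps(1))
    then show "u \<rightarrow>\<^sup>*\<^bsub>with_proj (mk_symmetric T)\<^esub> v"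
      using T.reachable_mk_symmetric_eq[OF sym_T] by blast
  qed
  moreover have "\<not> (\<exists>c. T.cycle c \<and> 3 \<le> length c)"
  proof
    assume "\<exists>c. T.cycle c \<and> 3 \<le> length c"
    then obtain c where c: "T.cycle c" "3 \<le> length c" by blast
    have "length c < 3"
    proof (rule T.no_cycle_if_parents[of par rank, OF _ c(1)])
      fix e assume e: "e \<in> arcs T"
      then show "(par (tail T e) = head T e \<and> rank (head T e) < rank (tail T e)) \<or>
          (par (head T e) = tail T e \<and> rank (tail T e) < rank (head T e))"
        using par[of "tail G e"] par[of "head G e"] T.wellformed[OF e] by auto
    qed
    then show False using c(2) by simp
  qed
  ultimately have tree: "undirected_tree T"
    unfolding undirected_tree_def using T.graph_axioms by blast
  have "successively (\<lambda>u v. (u, v) \<in> arcs_ends T) p"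
  proof -
    have "(u, v) \<in> arcs_ends T" if "v \<in> set p" "v \<noteq> hd p \<and> par v = u" for u v
      using to_parent[of v] that p(3) arcs_ends_symmetric[OF sym_T] by blast
    then show ?thesis using spine by (auto elim!: successively_mono)
  qed
  then have "vpath p T"
    using p by (intro vpathI vwalkI set_vwalk_arcs_subset) auto
  moreover have "verts3 T \<subseteq> set p"
  proof
    fix v assume "v \<in> verts3 T"
    then have v: "v \<in> verts G" "2 < in_degree T v" by (auto simp: verts3_def)
    show "v \<in> set p"
    proof (rule ccontr)
      assume "v \<notin> set p"
      \<comment> \<open>The children of \<open>v\<close>. An arc into \<open>v\<close> comes from a
        child or from the parent, and without parallel arcs the tails are distinct.\<close>
      define W where "W = {w \<in> verts G - {hd p}. par w = v}"
      have finW: "finite W" by (simp add: W_def)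
      have "card W \<le> 1"
        using legs \<open>v \<notin> set p\<close> finW unfolding One_nat_def card_le_Suc0_iff_eq[OF finW]
        by (auto simp: W_def)
      have "inj_on (tail G) (in_arcs T v)"
        using no_multi_arcs by (auto simp: inj_on_def arc_to_ends_def)
      moreover have "tail G ` in_arcs T v \<subseteq> insert (par v) W"
        by (auto simp: W_def)
      ultimately have "in_degree T v \<le> card (insert (par v) W)"
        unfolding in_degree_def using finW by (metis card_inj_on_le finite_insert)
      also have "\<dots> \<le> 2" using \<open>card W \<le> 1\<close> card_insert_le_m1[of 2 W "par v"] by simp
      finally show False using v(2) by simp
    qed
  qed
  ultimately have "generalized_caterpillar T"
    unfolding generalized_caterpillar_def using tree by blast
  moreover have "spanning T G"
    unfolding spanning_def subgraph_def compatible_def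
    using wf_digraph_axioms T.wf_digraph_axioms by auto
  ultimately show ?thesis unfolding spanning_generalized_caterpillar_def by blast
qed

section \<open>Assembling the argument for a graph given as a digraph\<close>

theorem theorem3:
  fixes G :: "('a, 'b) pre_digraph"
  assumes "graph G"
    and "connected G"
    and "independence_number G \<le> 2 * vertex_connectivity G + 1"
  shows "\<exists>T. spanning_generalized_caterpillar T G"
proof -
  interpret graph G by fact
  define E where "E u v \<longleftrightarrow> u \<rightarrow>\<^bsub>G\<^esub> v" for u v
  interpret A: adjacency E
    by unfold_locales (auto simp: E_def intro: arcs_ends_symmetric[OF sym_arcs] dest: adj_not_same)
  have "{card S | S. independent_set G S} = card ` {I. I \<subseteq> verts G \<and> A.indep I}"
    by (auto simp: independent_set_def A.indep_def E_def)
  then have alpha: "A.alpha (verts G) = independence_number G"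
    by (simp add: independence_number_def A.alpha_def)
  have "verts G \<noteq> {}"
    using \<open>connected G\<close> by (auto simp: connected_def strongly_connected_def)
  moreover have conn: "vertex_connectivity G \<le> card (verts G - A - B)"
    if "A \<subseteq> verts G" "B \<subseteq> verts G" "A \<noteq> {}" "B \<noteq> {}" "A \<inter> B = {}" "A.apart A B" for A B
    using that A.apart_commute[of A B]
    by (intro vertex_connectivity_le) (auto simp: A.apart_def E_def)
  ultimately obtain p q where pq: "p \<noteq> []" "A.is_path p" "set p \<subseteq> verts G" "distinct q"
    "set q = verts G" "successively (\<lambda>u v. E u v \<or> u \<in> set p \<and> v \<in> set p) q"
    by (rule A.hamiltonian_after_completing_path[OF finite_verts _ _ assms(3)[folded alpha]])
  show ?thesis
  proof (rule A.caterpillar_parents[OF pq])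
    fix par and rank :: "'a \<Rightarrow> nat"
    assume "\<And>v. v \<in> verts G \<Longrightarrow> v \<noteq> hd p \<Longrightarrow> par v \<in> verts G \<and> E v (par v) \<and> rank (par v) < rank v"
      and "successively (\<lambda>u v. v \<noteq> hd p \<and> par v = u) p"
      and "\<And>v w. v \<in> verts G - {hd p} \<Longrightarrow> w \<in> verts G - {hd p} \<Longrightarrow> par v = par w \<Longrightarrow>
        par v \<notin> set p \<Longrightarrow> v = w"
    then show ?thesis
      using pq(1-3) unfolding A.is_path_def E_def
      by (intro spanning_caterpillar_if_parents[OF \<open>graph G\<close>, of p par rank]) blast+
  qed
qed

end
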